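(* Let $p$ be a prime number. For any integers $a, b \in \{0, 1, \ldots, p-1\}$ with $a \neq b$ and $m, n \in \{0, 1, \ldots, p-1\}$, we have the following congruence modulo $p$: $$\sum_{\substack{k=0 \\ k \not\equiv -a, -b}}^{p-1} \frac{(a+k)^m}{(b+k)^n} \equiv \begin{cases} (-1)^{n+1}(a-b)^{p-1-n}, & \text{if } m=0 \text{ and } n \in \{1, 2, \ldots, p-2\},\\ -(a-b)^m, & \text{if } n=p-1 \text{ and } m \in \{1, 2, \ldots, p-2\},\\ -2, & \text{if } m, n \in \{0, p-1\},\\ -(a-b)^{m-n}\binom{m}{n}, & \text{otherwise}. \end{cases}$$
   Context: Congruences are in $\mathbb{Z}/p\mathbb{Z}$: a quotient $x/y$ with $p \nmid y$ means $x$ times the inverse of $y$ modulo $p$, and negative powers of integers prime to $p$ are interpreted likewise. Zeroth powers equal $1$. The conditions $k \not\equiv -a, -b$ are modulo $p$: the sum omits both the residue $-a$ and the residue $-b$. Binomial coefficients $\binom{u}{v}$ are $0$ unless $0 \le v \le u$. *)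

theory Defs
  imports "HOL-Number_Theory.Number_Theory" "HOL-Number_Theory.Modular_Inverse"
begin

text \<open>
  Elements of \<open>\<int>/p\<int>\<close> are represented by integers and equality by congruence modulo \<open>p\<close>.
  The two operations below are only meaningful, and only used, when \<open>y\<close>
  (for a negative exponent, \<open>x\<close>) is coprime to \<open>p\<close>.
\<close>

definition mod_quot :: "int \<Rightarrow> int \<Rightarrow> int \<Rightarrow> int" where
  "mod_quot p x y = x * modular_inverse p y"

definition mod_powi :: "int \<Rightarrow> int \<Rightarrow> int \<Rightarrow> int" where
  "mod_powi p x e = (if e \<ge> 0 then x ^ nat e else modular_inverse p x ^ nat (- e))"

end

theory Submission
  imports Defs
begin

text \<open>
  For \<open>y\<close> prime to \<open>p\<close>, Fermat's little theorem turns \<open>y\<^sup>-\<^sup>n\<close> into \<open>y\<^bsup>p-1-n\<^esup>\<close>, so the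
  quotients become values of a polynomial. With \<open>c = a - b\<close>, \<open>e = p - 1 - n\<close> and \<open>x = b + k\<close>,
  the sum is that of \<open>(c + x)\<^sup>m x\<^sup>e\<close> over all residues \<open>x\<close> other than \<open>- c\<close> and \<open>0\<close>.
  Including these two residues adds, modulo \<open>p\<close>, exactly \<open>0\<^sup>m (- c)\<^sup>e\<close> and \<open>c\<^sup>m 0\<^sup>e\<close>, which
  vanish unless \<open>m = 0\<close> and \<open>n = p - 1\<close> respectively.

  The complete sum is expanded by the binomial theorem. The sum of \<open>x\<^sup>t\<close> over all residues is
  \<open>- 1\<close> if \<open>t\<close> is a positive multiple of \<open>p - 1\<close> and \<open>0\<close> otherwise (\<open>sum_residues_power\<close>), and
  the exponents \<open>i + e\<close> that occur lie between \<open>0\<close> and \<open>2 (p - 1)\<close>. Hence only \<open>i = n\<close>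
  survives, and also \<open>i = p - 1\<close> when \<open>m = p - 1\<close> and \<open>n = 0\<close> (\<open>sum_residues_binomial\<close>).
  The main term is \<open>- (m choose n) c\<^bsup>m-n\<^esup>\<close>; the exceptional cases of the formula
  are those where one of the two added terms or the extra exponent \<open>2 (p - 1)\<close> contributes.
\<close>

section \<open>Sums over all residues\<close>

text \<open>
  An affine map with invertible slope permutes the residues. Translations serve to substitute
  \<open>x = b + k\<close>, and dilations by a primitive root to evaluate power sums.
\<close>
lemma sum_residues_affine:
  fixes p u v :: int and f :: "int \<Rightarrow> int"
  assumes "p > 0" and "coprime u p"
    and periodic: "\<And>x y. [x = y] (mod p) \<Longrightarrow> [f x = f y] (mod p)"
  shows "[(\<Sum>k\<in>{0..p - 1}. f (u * k + v)) = (\<Sum>k\<in>{0..p - 1}. f k)] (mod p)"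
proof -
  define h where "h = (\<lambda>k. (u * k + v) mod p)"
  have "inj_on h {0..p - 1}"
  proof (rule inj_onI)
    fix k l assume kl: "k \<in> {0..p - 1}" "l \<in> {0..p - 1}" "h k = h l"
    then have "[u * k + v = u * l + v] (mod p)"
      by (simp add: h_def cong_def)
    then have "[k = l] (mod p)"
      using assms(2) by (simp add: cong_add_rcancel cong_mult_lcancel)
    then show "k = l"
      using kl by (intro cong_less_imp_eq_int[of k p l]) auto
  qed
  moreover have "h ` {0..p - 1} \<subseteq> {0..p - 1}"
    using \<open>p > 0\<close> by (auto simp: h_def)
  ultimately have "bij_betw h {0..p - 1} {0..p - 1}"
    by (simp add: bij_betw_def endo_inj_surj)
  then have "(\<Sum>k\<in>{0..p - 1}. f (h k)) = (\<Sum>k\<in>{0..p - 1}. f k)"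
    by (rule sum.reindex_bij_betw)
  moreover have "[(\<Sum>k\<in>{0..p - 1}. f (u * k + v)) = (\<Sum>k\<in>{0..p - 1}. f (h k))] (mod p)"
    by (intro cong_sum periodic) (simp add: h_def)
  ultimately show ?thesis by simp
qed

lemma fermat_theorem_int:
  fixes x :: int
  assumes "prime p" and "\<not> int p dvd x"
  shows "[x ^ (p - 1) = 1] (mod int p)"
proof -
  have p: "int p > 0" using assms(1) prime_gt_0_nat by simp
  define y where "y = nat (x mod int p)"
  have y: "int y = x mod int p" using p by (simp add: y_def)
  have "\<not> int p dvd int y" using assms(2) by (simp add: y dvd_mod_iff)
  then have "[y ^ (p - 1) = 1] (mod p)"
    using fermat_theorem[OF assms(1)] by simp
  then have "[int (y ^ (p - 1)) = int 1] (mod int p)"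
    by (simp only: cong_int_iff)
  then have "[(x mod int p) ^ (p - 1) = 1] (mod int p)"
    by (simp add: y)
  then show ?thesis by (simp add: cong_def power_mod)
qed

text \<open>
  If \<open>p - 1\<close> divides \<open>t > 0\<close>, every nonzero residue contributes \<open>1\<close>. Otherwise a primitive root
  \<open>g\<close> satisfies \<open>g\<^sup>t \<noteq> 1\<close>, while replacing \<open>k\<close> by \<open>g k\<close> multiplies the sum by \<open>g\<^sup>t\<close> without
  changing it, so the sum vanishes. The case \<open>t = 0\<close> stands apart because \<open>0\<^sup>0 = 1\<close> makes
  the sum equal to \<open>p\<close>.
\<close>
lemma sum_residues_power:
  assumes "prime p"
  shows "[(\<Sum>k\<in>{0..int p - 1}. k ^ t) = (if t > 0 \<and> p - 1 dvd t then - 1 else 0)] (mod int p)"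
proof (cases "p - 1 dvd t")
  case True
  then obtain q where q: "t = (p - 1) * q" by auto
  have p: "p > 1" using assms prime_gt_1_nat by blast
  show ?thesis
  proof (cases "t = 0")
    case True
    then show ?thesis by (simp add: cong_def)
  next
    case False
    have "{0..int p - 1} = insert 0 {1..int p - 1}" using p by auto
    then have "(\<Sum>k\<in>{0..int p - 1}. k ^ t) = (\<Sum>k\<in>{1..int p - 1}. k ^ t)"
      using False by simp
    also have "[\<dots> = (\<Sum>k\<in>{1..int p - 1}. 1)] (mod int p)"
    proof (rule cong_sum)
      fix k assume k: "k \<in> {1..int p - 1}"
      then have "\<not> int p dvd k" by (auto dest: zdvd_imp_le)
      then have "[(k ^ (p - 1)) ^ q = 1 ^ q] (mod int p)"
        using assms by (intro cong_pow fermat_theorem_int)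
      then show "[k ^ t = 1] (mod int p)" by (simp add: q power_mult)
    qed
    also have "(\<Sum>k\<in>{1..int p - 1}. 1) = int p - 1" using p by simp
    also have "[int p - 1 = - 1] (mod int p)" by (simp add: cong_iff_dvd_diff)
    finally show ?thesis using False \<open>p - 1 dvd t\<close> by simp
  qed
next
  case False
  have p: "p > 1" using assms prime_gt_1_nat by blast
  obtain g where g: "residue_primroot p g"
    using prime_primitive_root_exists[OF p assms] by blast
  define S where "S = (\<Sum>k\<in>{0..int p - 1}. k ^ t)"
  have "ord p g = p - 1" "coprime p g"
    using g assms by (auto simp: residue_primroot_def totient_prime)
  then have "\<not> [g ^ t = 1] (mod p)"
    using False by (simp only: ord_divides not_False_eq_True)
  then have "\<not> [int (g ^ t) = int 1] (mod int p)"
    by (simp only: cong_int_iff not_False_eq_True)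
  then have "\<not> int p dvd int g ^ t - 1"
    by (simp add: cong_iff_dvd_diff)
  moreover have "[(\<Sum>k\<in>{0..int p - 1}. (int g * k + 0) ^ t) = S] (mod int p)"
    unfolding S_def using p \<open>coprime p g\<close>
    by (intro sum_residues_affine cong_pow) (auto simp: coprime_commute)
  then have "[int g ^ t * S = S] (mod int p)"
    by (simp add: S_def power_mult_distrib sum_distrib_left)
  then have "int p dvd (int g ^ t - 1) * S"
    by (simp add: cong_iff_dvd_diff algebra_simps)
  ultimately have "int p dvd S"
    using assms by (simp add: prime_dvd_mult_iff)
  then show ?thesis using False by (simp add: S_def cong_0_iff)
qed

text \<open>
  The coefficients extracted here are those of \<open>x\<^bsup>p-1\<^esup>\<close> and \<open>x\<^bsup>2(p-1)\<^esup>\<close> in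
  \<open>(c + x)\<^sup>m x\<^bsup>p-1-n\<^esup>\<close>; the second is nonzero only when the polynomial has degree
  \<open>2 (p - 1)\<close>, that is, for \<open>m = p - 1\<close> and \<open>n = 0\<close>.
\<close>
lemma sum_residues_binomial:
  fixes c :: int
  assumes "prime p" and "m \<le> p - 1" and "n \<le> p - 1"
  shows "[(\<Sum>x\<in>{0..int p - 1}. (c + x) ^ m * x ^ (p - 1 - n)) =
          - (int (m choose n) * c ^ (m - n)) - (if m = p - 1 \<and> n = 0 then 1 else 0)] (mod int p)"
proof -
  have p: "p > 1" using assms prime_gt_1_nat by blast
  have "(\<Sum>x\<in>{0..int p - 1}. (c + x) ^ m * x ^ (p - 1 - n)) =
        (\<Sum>x\<in>{0..int p - 1}. \<Sum>i\<le>m. int (m choose i) * c ^ (m - i) * x ^ (i + (p - 1 - n)))"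
    by (subst add.commute) (simp add: binomial_ring sum_distrib_left power_add mult_ac)
  also have "\<dots> = (\<Sum>i\<le>m. int (m choose i) * c ^ (m - i) * (\<Sum>x\<in>{0..int p - 1}. x ^ (i + (p - 1 - n))))"
    by (subst sum.swap) (simp add: sum_distrib_left)
  finally have expand: "(\<Sum>x\<in>{0..int p - 1}. (c + x) ^ m * x ^ (p - 1 - n)) =
      (\<Sum>i\<le>m. int (m choose i) * c ^ (m - i) * (\<Sum>x\<in>{0..int p - 1}. x ^ (i + (p - 1 - n))))" .
  have reduce: "[(\<Sum>i\<le>m. int (m choose i) * c ^ (m - i) * (\<Sum>x\<in>{0..int p - 1}. x ^ (i + (p - 1 - n)))) =
    (\<Sum>i\<le>m. int (m choose i) * c ^ (m - i) *
      (- (if i = n then 1 else 0) - (if i = p - 1 \<and> n = 0 then 1 else 0)))] (mod int p)"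
  proof (intro cong_sum cong_mult cong_refl)
    fix i assume "i \<in> {..m}"
    then have i: "i \<le> p - 1" using assms by simp
    have "(i + (p - 1 - n) > 0 \<and> p - 1 dvd i + (p - 1 - n)) \<longleftrightarrow> i = n \<or> i = p - 1 \<and> n = 0"
    proof
      assume *: "i + (p - 1 - n) > 0 \<and> p - 1 dvd i + (p - 1 - n)"
      then obtain q where q: "i + (p - 1 - n) = (p - 1) * q" by auto
      \<comment> \<open>Both \<open>i\<close> and \<open>p - 1 - n\<close> are at most \<open>p - 1\<close>, so the multiplier is \<open>1\<close> (giving \<open>i = n\<close>)
        or \<open>2\<close> (forcing both bounds to be attained).\<close>
      have "q \<noteq> 0" using * q by (metis less_irrefl mult_0_right)
      have "(p - 1) * q \<le> (p - 1) * 2" using i q by linarith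
      then have "q \<le> 2" using p by simp
      with \<open>q \<noteq> 0\<close> have "q = 1 \<or> q = 2" by auto
      then show "i = n \<or> i = p - 1 \<and> n = 0" using q i assms(3) by auto
    next
      assume "i = n \<or> i = p - 1 \<and> n = 0"
      then have "i + (p - 1 - n) = p - 1 \<or> i + (p - 1 - n) = (p - 1) * 2"
        using assms(3) by auto
      then show "i + (p - 1 - n) > 0 \<and> p - 1 dvd i + (p - 1 - n)"
        using p by (metis dvd_refl dvd_triv_left nat_0_less_mult_iff zero_less_diff zero_less_numeral)
    qed
    then show "[(\<Sum>x\<in>{0..int p - 1}. x ^ (i + (p - 1 - n))) =
       - (if i = n then 1 else 0) - (if i = p - 1 \<and> n = 0 then 1 else 0)] (mod int p)"
      using sum_residues_power[OF assms(1), of "i + (p - 1 - n)"] p by auto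
  qed
  have "(\<Sum>i\<le>m. int (m choose i) * c ^ (m - i) *
      (- (if i = n then 1 else 0) - (if i = p - 1 \<and> n = 0 then 1 else 0))) =
      (\<Sum>i\<le>m. if i = n then - (int (m choose i) * c ^ (m - i)) else 0) -
      (\<Sum>i\<le>m. if i = p - 1 then if n = 0 then int (m choose i) * c ^ (m - i) else 0 else 0)"
    unfolding sum_subtractf[symmetric] by (intro sum.cong) auto
  also have "\<dots> = - (int (m choose n) * c ^ (m - n)) - (if m = p - 1 \<and> n = 0 then 1 else 0)"
    using assms(2) by (auto simp: sum.delta)
  finally show ?thesis using reduce by (simp only: expand)
qed

section \<open>The sum of quotients\<close>

lemma mod_quot_power_cong:
  assumes "prime p" and "n \<le> p - 1" and "\<not> int p dvd y"
  shows "[mod_quot (int p) x (y ^ n) = x * y ^ (p - 1 - n)] (mod int p)"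
proof -
  have "coprime (int p) y"
    using assms(1,3) by (simp add: prime_imp_coprime)
  then have cop: "coprime (int p) (y ^ n)" by simp
  have "[y ^ n * modular_inverse (int p) (y ^ n) = 1] (mod int p)"
    using cop by (intro cong_modular_inverse1) (simp add: coprime_commute)
  moreover have "[y ^ n * y ^ (p - 1 - n) = 1] (mod int p)"
    using fermat_theorem_int[OF assms(1,3)] assms(2) by (simp flip: power_add del: One_nat_def diff_diff_left)
  ultimately have "[y ^ n * modular_inverse (int p) (y ^ n) = y ^ n * y ^ (p - 1 - n)] (mod int p)"
    by (metis cong_sym cong_trans)
  then have "[modular_inverse (int p) (y ^ n) = y ^ (p - 1 - n)] (mod int p)"
    using cop by (simp add: cong_mult_lcancel coprime_commute)
  then show ?thesis
    unfolding mod_quot_def by (rule cong_scalar_left)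
qed

theorem theorem2p3:
  fixes p :: nat and a b :: int and m n :: nat
  assumes "prime p"
    and "a \<in> {0..int p - 1}" and "b \<in> {0..int p - 1}" and "a \<noteq> b"
    and "m \<in> {0..p - 1}" and "n \<in> {0..p - 1}"
  shows "[(\<Sum>k \<in> {k \<in> {0..int p - 1}. \<not> [k = - a] (mod int p) \<and> \<not> [k = - b] (mod int p)}.
             mod_quot (int p) ((a + k) ^ m) ((b + k) ^ n)) =
          (if m = 0 \<and> n \<in> {1..p - 2} then (- 1) ^ (n + 1) * (a - b) ^ (p - 1 - n)
           else if n = p - 1 \<and> m \<in> {1..p - 2} then - ((a - b) ^ m)
           else if m \<in> {0, p - 1} \<and> n \<in> {0, p - 1} then - 2
           else - (mod_powi (int p) (a - b) (int m - int n) * int (m choose n)))] (mod int p)"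
    (is "[?S = ?R] (mod _)")
proof -
  have p: "p > 1" using assms(1) prime_gt_1_nat by blast
  define c where "c = a - b"
  define e where "e = p - 1 - n"
  define K where "K = {k \<in> {0..int p - 1}. \<not> [k = - a] (mod int p) \<and> \<not> [k = - b] (mod int p)}"
  define g where "g = (\<lambda>k. (a + k) ^ m * (b + k) ^ e)"
  \<comment> \<open>The representatives in \<open>{0..p - 1}\<close> of the two omitted residues.\<close>
  define ka kb where "ka = (- a) mod int p" and "kb = (- b) mod int p"
  have ndvd: "\<not> int p dvd c"
  proof
    assume "int p dvd c"
    then have "[a = b] (mod int p)" by (simp add: c_def cong_iff_dvd_diff)
    then show False using assms cong_less_imp_eq_int[of a "int p" b] by auto
  qed
  have ka: "[k = - a] (mod int p) \<longleftrightarrow> k = ka" and kb: "[k = - b] (mod int p) \<longleftrightarrow> k = kb"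
    if "k \<in> {0..int p - 1}" for k
    using that by (auto simp: ka_def kb_def cong_def)
  have mem: "ka \<in> {0..int p - 1}" "kb \<in> {0..int p - 1}"
    using p by (auto simp: ka_def kb_def)
  have "ka \<noteq> kb"
    using ndvd unfolding ka_def kb_def c_def
    by (metis cong_def cong_iff_dvd_diff cong_minus_minus_iff)
  have split: "(\<Sum>k\<in>{0..int p - 1}. g k) = g ka + g kb + sum g K"
  proof -
    have "K = {0..int p - 1} - {ka, kb}"
      unfolding K_def using ka kb by auto
    then have "sum g {0..int p - 1} = sum g K + sum g {ka, kb}"
      using mem by (simp add: sum.subset_diff)
    then show ?thesis using \<open>ka \<noteq> kb\<close> by simp
  qed
  have restrict: "[?S = sum g K] (mod int p)"
    unfolding K_def[symmetric]
  proof (rule cong_sum)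
    fix k assume "k \<in> K"
    then have "\<not> [k = - b] (mod int p)" by (simp add: K_def)
    then have "\<not> int p dvd b + k" by (simp add: cong_iff_dvd_diff add.commute)
    then show "[mod_quot (int p) ((a + k) ^ m) ((b + k) ^ n) = g k] (mod int p)"
      unfolding g_def e_def using assms by (intro mod_quot_power_cong) auto
  qed
  have gka: "[g ka = 0 ^ m * (- c) ^ e] (mod int p)"
  proof -
    have "[a + ka = a + - a] (mod int p)" "[b + ka = b + - a] (mod int p)"
      unfolding ka_def by (intro cong_add cong_refl cong_mod_leftI)+
    then show ?thesis unfolding g_def c_def
      by (intro cong_mult cong_pow) auto
  qed
  have gkb: "[g kb = c ^ m * 0 ^ e] (mod int p)"
  proof -
    have "[a + kb = a + - b] (mod int p)" "[b + kb = b + - b] (mod int p)"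
      unfolding kb_def by (intro cong_add cong_refl cong_mod_leftI)+
    then show ?thesis unfolding g_def c_def
      by (intro cong_mult cong_pow) auto
  qed
  have "[(\<Sum>k\<in>{0..int p - 1}. (c + (1 * k + b)) ^ m * (1 * k + b) ^ e) =
         (\<Sum>x\<in>{0..int p - 1}. (c + x) ^ m * x ^ e)] (mod int p)"
    using p by (intro sum_residues_affine[where f = "\<lambda>x. (c + x) ^ m * x ^ e"]
                      cong_mult cong_pow cong_add cong_refl) auto
  then have "[sum g {0..int p - 1} = (\<Sum>x\<in>{0..int p - 1}. (c + x) ^ m * x ^ e)] (mod int p)"
    by (simp add: g_def c_def algebra_simps)
  also have "[(\<Sum>x\<in>{0..int p - 1}. (c + x) ^ m * x ^ e) =
      - (int (m choose n) * c ^ (m - n)) - (if m = p - 1 \<and> n = 0 then 1 else 0)] (mod int p)"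
    unfolding e_def using assms by (intro sum_residues_binomial) auto
  finally have full: "[g ka + g kb + sum g K =
      - (int (m choose n) * c ^ (m - n)) - (if m = p - 1 \<and> n = 0 then 1 else 0)] (mod int p)"
    unfolding split .
  \<comment> \<open>All four cases of the theorem are read off from this uniform formula.\<close>
  define T where "T = - (int (m choose n) * c ^ (m - n)) - (if m = p - 1 \<and> n = 0 then 1 else 0)
      - 0 ^ m * (- c) ^ e - c ^ m * 0 ^ e"
  have "[sum g K = T] (mod int p)"
    using cong_diff[OF cong_diff[OF full gka] gkb] by (simp add: T_def)
  with restrict have S: "[?S = T] (mod int p)"
    by (rule cong_trans)
  have fermat: "[c ^ (p - 1) = 1] (mod int p)" "[(- c) ^ (p - 1) = 1] (mod int p)"
    using ndvd assms(1) by (auto intro!: fermat_theorem_int simp del: One_nat_def)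
  have m: "m \<le> p - 1" and n: "n \<le> p - 1" using assms by auto
  consider (m0) "m = 0" "n \<in> {1..p - 2}" | (n_top) "n = p - 1" "m \<in> {1..p - 2}"
    | (corner) "m \<in> {0, p - 1}" "n \<in> {0, p - 1}"
    | (generic) "m \<noteq> 0" "n \<noteq> p - 1" "\<not> (m = p - 1 \<and> n = 0)"
    using m n by fastforce
  then have "[T = ?R] (mod int p)"
  proof cases
    case m0
    \<comment> \<open>The remaining term \<open>- (- c)\<^sup>e\<close> has the sign \<open>(- 1)\<^bsup>n+1\<^esup>\<close>, since \<open>n + e = p - 1\<close> and
      \<open>(- 1)\<^bsup>p-1\<^esup> \<equiv> 1\<close>; Fermat's theorem gives the latter for \<open>p = 2\<close> as well.\<close>
    have "[(- 1) ^ (p - 1) = (1 :: int)] (mod int p)"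
      using p assms(1) by (intro fermat_theorem_int) auto
    then have "[(- 1) ^ n * (- 1) ^ e = (1 :: int)] (mod int p)"
      using n by (simp add: e_def flip: power_add del: One_nat_def diff_diff_left)
    then have "[(- 1) ^ n * ((- 1) ^ n * (- 1) ^ e) = (- 1) ^ n * (1 :: int)] (mod int p)"
      by (rule cong_scalar_left)
    moreover have "(- 1) ^ n * ((- 1) ^ n * (- 1) ^ e) = (- 1 :: int) ^ e"
      by (simp only: mult.assoc[symmetric] power_mult_distrib[symmetric]) simp
    ultimately have "[(- 1) ^ e = (- 1 :: int) ^ n] (mod int p)"
      by simp
    then have "[- ((- 1) ^ e * c ^ e) = - ((- 1) ^ n * c ^ e)] (mod int p)"
      by (simp add: cong_minus_minus_iff cong_scalar_right)
    then have *: "[- ((- c) ^ e) = (- 1) ^ (n + 1) * c ^ e] (mod int p)"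
      by (simp add: power_minus[of c])
    have "e > 0" "m choose n = 0" using m0 p by (auto simp: e_def)
    then have "T = - ((- c) ^ e)"
      using m0 by (auto simp: T_def power_0_left binomial_eq_0)
    with * show ?thesis
      using m0 by (simp add: c_def e_def)
  next
    case n_top
    then have "e = 0" "m choose n = 0" "n \<noteq> 0" "m \<noteq> 0" using p by (auto simp: e_def)
    then have "T = - (c ^ m)" by (auto simp: T_def power_0_left binomial_eq_0)
    then show ?thesis using n_top by (auto simp: c_def)
  next
    case corner
    have R: "?R = - 2" using corner p by auto
    have "[T = - 2] (mod int p)"
    proof -
      \<comment> \<open>At each corner \<open>(m, n)\<close> two of the four terms of \<open>T\<close> vanish, and the other two are each
        congruent to \<open>- 1\<close>.\<close>
      have *: "[- 1 - (- c) ^ (p - 1) = - 1 - 1] (mod int p)" "[- (c ^ (p - 1)) - 1 = - 1 - 1] (mod int p)"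
         "[- 1 - c ^ (p - 1) = - 1 - 1] (mod int p)"
        by (intro cong_diff cong_refl cong_minus_minus_iff[THEN iffD2] fermat)+
      show ?thesis using corner p * by (auto simp: T_def e_def power_0_left binomial_eq_0)
    qed
    then show ?thesis unfolding R .
  next
    case generic
    have R: "?R = - (mod_powi (int p) c (int m - int n) * int (m choose n))"
      using generic m n by (auto simp: c_def)
    have "e > 0" using generic n by (auto simp: e_def)
    then have "T = - (int (m choose n) * c ^ (m - n))"
      using generic by (auto simp: T_def power_0_left)
    \<comment> \<open>For \<open>m < n\<close> the exponents differ, as \<open>m - n\<close> truncates on the left, but the binomial
      coefficient is zero.\<close>
    also have "int (m choose n) * c ^ (m - n) = mod_powi (int p) c (int m - int n) * int (m choose n)"
      by (cases "n \<le> m") (auto simp: mod_powi_def nat_diff_distrib binomial_eq_0)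
    finally show ?thesis unfolding R by simp
  qed
  with S show ?thesis by (rule cong_trans)
qed

end
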